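(* Let $(A,W)$ be a concise representation of a game in characteristic form with transferable utility, with coalition values $v(B)$, and let $u^A=(u^A_a)_{a\in A}\in V(A)$ be an outcome. Then $u^A$ is blocked by some coalition if and only if it is blocked by some coalition $B$ through a value listed for it in $W$, i.e. if and only if there is $(B,w_B)\in W$ such that $w_B>\sum_{b\in B}u^A_b$.
   Context: A coalition is a nonempty subset of the finite player set $A$. A concise representation of a game in characteristic form with transferable utility consists of $A$ and a finite set $W$ of pairs $(B, w_B)$, where $B$ is a coalition and $w_B$ is a real number (at most one pair for each $B$). It is required that every singleton $\{a\}$, $a\in A$, occurs in $W$ (with value $0$ if no other value is specified for it). The value of a coalition $B$ is $$v(B) = \max\Big\{\sum_{i=1}^r w_{B_i} : r\ge 1,\ B_1,\ldots,B_r \text{ pairwise disjoint coalitions},\ \textstyle\bigcup_i B_i = B,\ (B_i,w_{B_i})\in W \text{ for all } i\Big\}.$$ The utility possibility set of $B$ is $V(B)=\{(u_b)_{b\in B} : \sum_{b\in B}u_b\le v(B)\}$. An outcome is a vector $u^A\in V(A)$, i.e. $\sum_{a\in A}u^A_a\le v(A)$. It is blocked by a coalition $B\subseteq A$ if $v(B)>\sum_{b\in B}u^A_b$. *)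

theory Defs
  imports Complex_Main "HOL-Library.FuncSet" "HOL-Library.Disjoint_Sets"
begin

definition coalition :: "'a set \<Rightarrow> 'a set \<Rightarrow> bool" where
  "coalition A B \<longleftrightarrow> B \<subseteq> A \<and> B \<noteq> {}"

(* An unlisted singleton has value 0: W is the list with such pairs ({a}, 0) already added. *)
definition concise_representation :: "'a set \<Rightarrow> ('a set \<times> real) set \<Rightarrow> bool" where
  "concise_representation A W \<longleftrightarrow>
     finite A \<and> finite W \<and>
     (\<forall>(B, w) \<in> W. coalition A B) \<and>
     single_valued W \<and>
     (\<forall>a\<in>A. \<exists>w. ({a}, w) \<in> W)"

definition partition_values :: "'a set \<Rightarrow> ('a set \<times> real) set \<Rightarrow> 'a set \<Rightarrow> real set" where
  "partition_values A W C =
     {\<Sum>i=1..r. w i | (r::nat) (B :: nat \<Rightarrow> 'a set) (w :: nat \<Rightarrow> real).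
        r \<ge> 1 \<and> (\<forall>i\<in>{1..r}. coalition A (B i)) \<and> disjoint_family_on B {1..r} \<and>
        (\<Union>i\<in>{1..r}. B i) = C \<and> (\<forall>i\<in>{1..r}. (B i, w i) \<in> W)}"

(* Max is only meaningful on finite nonempty sets; the two lemmas below show that this is
   the case here for every coalition C. *)
definition coalition_value :: "'a set \<Rightarrow> ('a set \<times> real) set \<Rightarrow> 'a set \<Rightarrow> real" where
  "coalition_value A W C = Max (partition_values A W C)"

lemma finite_partition_values:
  assumes "concise_representation A W"
  shows "finite (partition_values A W C)"
proof (rule finite_subset)
  show "partition_values A W C \<subseteq> (\<lambda>S. \<Sum>p\<in>S. snd p) ` Pow W"
  proof
    fix s assume "s \<in> partition_values A W C"
    then obtain r :: nat and B w where
      s: "s = (\<Sum>i=1..r. w i)" and co: "\<forall>i\<in>{1..r}. coalition A (B i)"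
      and disj: "disjoint_family_on B {1..r}" and W: "\<forall>i\<in>{1..r}. (B i, w i) \<in> W"
      unfolding partition_values_def by blast
    have "inj_on (\<lambda>i. (B i, w i)) {1..r}"
    proof (rule inj_onI, rule ccontr)
      fix i j assume ij: "i \<in> {1..r}" "j \<in> {1..r}" "(B i, w i) = (B j, w j)" "i \<noteq> j"
      then have "B i \<inter> B j = {}"
        using disj unfolding disjoint_family_on_def by blast
      moreover have "B i \<noteq> {}"
        using co ij(1) unfolding coalition_def by blast
      ultimately show False using ij(3) by simp
    qed
    then have "s = (\<Sum>p\<in>(\<lambda>i. (B i, w i)) ` {1..r}. snd p)"
      by (simp add: s sum.reindex)
    moreover have "(\<lambda>i. (B i, w i)) ` {1..r} \<in> Pow W"
      using W by auto
    ultimately show "s \<in> (\<lambda>S. \<Sum>p\<in>S. snd p) ` Pow W" by blast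
  qed
  show "finite ((\<lambda>S. \<Sum>p\<in>S. snd p) ` Pow W)"
    using assms by (simp add: concise_representation_def)
qed

lemma partition_values_nonempty:
  assumes "concise_representation A W" and C: "coalition A C"
  shows "partition_values A W C \<noteq> {}"
proof -
  have "finite A" "C \<noteq> {}" "C \<subseteq> A"
    using assms unfolding concise_representation_def coalition_def by blast+
  then have "finite C" by (blast intro: finite_subset)
  obtain f where f: "bij_betw f {1..card C} C"
    using ex_bij_betw_nat_finite_1 [OF \<open>finite C\<close>] by blast
  have "\<forall>a\<in>A. \<exists>w. ({a}, w) \<in> W"
    using assms(1) unfolding concise_representation_def by blast
  then obtain g where g: "\<forall>a\<in>A. ({a}, g a) \<in> W"
    by (rule bchoice [THEN exE])
  have inj: "inj_on f {1..card C}" and img: "f ` {1..card C} = C"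
    using f by (simp_all add: bij_betw_def)
  have "(1::nat) \<le> card C"
    using \<open>finite C\<close> \<open>C \<noteq> {}\<close> by (simp add: Suc_le_eq card_gt_0_iff)
  moreover have "\<forall>i\<in>{1..card C}. coalition A {f i}"
    using img \<open>C \<subseteq> A\<close> unfolding coalition_def by blast
  moreover have "disjoint_family_on (\<lambda>i. {f i}) {1..card C}"
    using inj unfolding disjoint_family_on_def inj_on_def by blast
  moreover have "(\<Union>i\<in>{1..card C}. {f i}) = C"
    using img by blast
  moreover have "\<forall>i\<in>{1..card C}. ({f i}, g (f i)) \<in> W"
    using g img \<open>C \<subseteq> A\<close> by blast
  ultimately have "\<exists>(r::nat) B w. (\<Sum>i=1..card C. g (f i)) = (\<Sum>i=1..r. w i) \<and>
      1 \<le> r \<and> (\<forall>i\<in>{1..r}. coalition A (B i)) \<and> disjoint_family_on B {1..r} \<and>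
      (\<Union>i\<in>{1..r}. B i) = C \<and> (\<forall>i\<in>{1..r}. (B i, w i) \<in> W)"
    by (intro exI[of _ "card C"] exI[of _ "\<lambda>i. {f i}"] exI[of _ "\<lambda>i. g (f i)"] conjI refl)
  then have "(\<Sum>i=1..card C. g (f i)) \<in> partition_values A W C"
    unfolding partition_values_def by (rule CollectI)
  then show ?thesis by blast
qed

(* Vectors indexed by B are the functions in B \<rightarrow>\<^sub>E UNIV, i.e. undefined outside B. *)
definition utility_set :: "'a set \<Rightarrow> ('a set \<times> real) set \<Rightarrow> 'a set \<Rightarrow> ('a \<Rightarrow> real) set" where
  "utility_set A W B = {u \<in> B \<rightarrow>\<^sub>E UNIV. (\<Sum>b\<in>B. u b) \<le> coalition_value A W B}"

definition blocked_by :: "'a set \<Rightarrow> ('a set \<times> real) set \<Rightarrow> ('a \<Rightarrow> real) \<Rightarrow> 'a set \<Rightarrow> bool" where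
  "blocked_by A W u B \<longleftrightarrow> coalition A B \<and> coalition_value A W B > (\<Sum>b\<in>B. u b)"

end

theory Submission
  imports Defs
begin

text \<open>A listed pair \<open>(B, w)\<close> is itself a one-block partition of \<open>B\<close>,
  so \<open>w\<close> is at most the value of \<open>B\<close>
  (\<open>listed_value_le_coalition_value\<close>); if \<open>w\<close> exceeds the payoff of
  \<open>B\<close>, then \<open>B\<close> blocks. Conversely, the value of a blocking coalition
  \<open>C\<close> is attained by some partition of \<open>C\<close> into listed coalitions. If no
  listed value exceeded the payoff of its coalition, adding these inequalities over the blocks would
  bound the value of \<open>C\<close> by its payoff (\<open>partition_value_le_sum\<close>), a
  contradiction. So some block of an optimal partition already blocks through its listed
  value.\<close>

lemma listed_value_in_partition_values:
  assumes "concise_representation A W" and "(B, w) \<in> W"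
  shows "w \<in> partition_values A W B"
proof -
  have "coalition A B"
    using assms unfolding concise_representation_def by blast
  then have "\<exists>(r::nat) B' w'. w = (\<Sum>i=1..r. w' i) \<and>
      1 \<le> r \<and> (\<forall>i\<in>{1..r}. coalition A (B' i)) \<and> disjoint_family_on B' {1..r} \<and>
      (\<Union>i\<in>{1..r}. B' i) = B \<and> (\<forall>i\<in>{1..r}. (B' i, w' i) \<in> W)"
    using assms(2)
    \<comment> \<open>The trivial partition: \<open>r = 1\<close>, with \<open>B\<close> as its only
      block.\<close>
    by (intro exI[of _ 1] exI[of _ "\<lambda>_. B"] exI[of _ "\<lambda>_. w"])
      (simp add: disjoint_family_on_def)
  then show ?thesis
    unfolding partition_values_def by (rule CollectI)
qed

lemma listed_value_le_coalition_value:
  assumes "concise_representation A W" and "(B, w) \<in> W"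
  shows "w \<le> coalition_value A W B"
  unfolding coalition_value_def
  using assms by (intro Max_ge finite_partition_values listed_value_in_partition_values)

text \<open>Payoffs are additive over disjoint blocks, so the bounds on the single blocks add up to
  a bound on the whole partition.\<close>

lemma partition_value_le_sum:
  assumes "finite A" and s: "s \<in> partition_values A W C"
    and le: "\<And>B w. (B, w) \<in> W \<Longrightarrow> w \<le> (\<Sum>b\<in>B. u b)"
  shows "s \<le> (\<Sum>b\<in>C. u b)"
proof -
  obtain r :: nat and B w where
    s: "s = (\<Sum>i=1..r. w i)" and co: "\<forall>i\<in>{1..r}. coalition A (B i)"
    and disj: "disjoint_family_on B {1..r}" and C: "(\<Union>i\<in>{1..r}. B i) = C"
    and W: "\<forall>i\<in>{1..r}. (B i, w i) \<in> W"
    using s unfolding partition_values_def by blast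
  have "s \<le> (\<Sum>i=1..r. \<Sum>b\<in>B i. u b)"
    unfolding s using W le by (intro sum_mono) blast
  also have "\<dots> = (\<Sum>b\<in>(\<Union>i\<in>{1..r}. B i). u b)"
  \<comment> \<open>Additivity needs finite blocks; they are subsets of the finite set
    \<open>A\<close>.\<close>
  proof (rule sum.UNION_disjoint [symmetric])
    show "\<forall>i\<in>{1..r}. finite (B i)"
      using co \<open>finite A\<close> unfolding coalition_def by (blast intro: finite_subset)
    show "\<forall>i\<in>{1..r}. \<forall>j\<in>{1..r}. i \<noteq> j \<longrightarrow> B i \<inter> B j = {}"
      using disj unfolding disjoint_family_on_def by blast
  qed simp
  finally show ?thesis
    unfolding C .
qed

theorem lemma2:
  fixes A :: "'a set" and W :: "('a set \<times> real) set" and u :: "'a \<Rightarrow> real"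
  assumes "concise_representation A W"
    and "u \<in> utility_set A W A"
  shows "(\<exists>B. blocked_by A W u B) \<longleftrightarrow> (\<exists>(B, w) \<in> W. w > (\<Sum>b\<in>B. u b))"
proof
  assume "\<exists>B. blocked_by A W u B"
  then obtain C where C: "coalition A C" "coalition_value A W C > (\<Sum>b\<in>C. u b)"
    unfolding blocked_by_def by blast
  \<comment> \<open>The maximum is attained, so the value of \<open>C\<close> comes from an actual
    partition.\<close>
  have v: "coalition_value A W C \<in> partition_values A W C"
    unfolding coalition_value_def
    using assms(1) C(1) by (intro Max_in finite_partition_values partition_values_nonempty)
  have "finite A"
    using assms(1) by (simp add: concise_representation_def)
  show "\<exists>(B, w) \<in> W. w > (\<Sum>b\<in>B. u b)"
  \<comment> \<open>Negating the claim bounds every listed value at once, so no particular block has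
    to be singled out.\<close>
  proof (rule ccontr)
    assume "\<not> ?thesis"
    then have "\<And>B w. (B, w) \<in> W \<Longrightarrow> w \<le> (\<Sum>b\<in>B. u b)"
      by fastforce
    then have "coalition_value A W C \<le> (\<Sum>b\<in>C. u b)"
      by (rule partition_value_le_sum [OF \<open>finite A\<close> v])
    then show False
      using C(2) by simp
  qed
next
  assume "\<exists>(B, w) \<in> W. w > (\<Sum>b\<in>B. u b)"
  then obtain B w where B: "(B, w) \<in> W" "w > (\<Sum>b\<in>B. u b)"
    by blast
  have "coalition A B"
    using assms(1) B(1) unfolding concise_representation_def by blast
  moreover have "w \<le> coalition_value A W B"
    using assms(1) B(1) by (rule listed_value_le_coalition_value)
  ultimately have "blocked_by A W u B"
    using B(2) by (simp add: blocked_by_def)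
  then show "\<exists>B. blocked_by A W u B" ..
qed

end
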